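(* The solutions of the Diophantine equation $$F_{n_1}+F_{n_2}=2^{z_1}+3^{z_2}$$ in non-negative integers $n_1,n_2,z_1,z_2$ with $n_1\ge n_2\ge 0$ and $z_2\ge z_1$ are exactly the following quadruples $(n_1,n_2,z_1,z_2)$: $$(3,0,0,0),\ (5,0,1,1),\ (7,0,2,2),\ (11,0,3,4),\ (1,1,0,0),\ (2,1,0,0),\ (2,2,0,0),$$ $$(3,3,0,1),\ (4,1,0,1),\ (4,2,0,1),\ (4,3,1,1),\ (5,5,0,2),\ (6,3,0,2),\ (6,4,1,2),$$ $$(6,5,2,2),\ (8,6,1,3),\ (9,1,3,3),\ (9,2,3,3),\ (10,9,3,4),\ (11,6,4,4).$$
   Context: $\{F_n\}_{n\ge 0}$ denotes the classical Fibonacci sequence: $F_0=0$, $F_1=1$, and $F_n=F_{n-1}+F_{n-2}$ for $n\ge 2$. *)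

theory Defs
  imports "HOL-Number_Theory.Fib"
begin

end

theory Submission
  imports Defs "HOL-Library.Code_Binary_Nat"
begin

text \<open>
  Since \<open>z\<^sub>1 \<le> z\<^sub>2\<close>, a bound on \<open>z\<^sub>2\<close> leaves finitely many quadruples, because
  Fibonacci numbers grow. So everything rests on the bound \<open>z\<^sub>2 < 5\<close>, that is, on the claim that
  \<open>F\<^sub>a + F\<^sub>b = 2\<^sup>c + 3\<^sup>5 3\<^sup>d\<close> has no solution in natural numbers (lemma \<open>no_solution_3_pow_5\<close>).
  The usual tool for such an equation is Baker's theory of linear forms in logarithms; the
  proof below uses congruences only.

  Modulo a fixed odd \<open>m\<close> the sequences \<open>F\<^sub>n\<close>, \<open>2\<^sup>n\<close> and \<open>3\<^sup>5 3\<^sup>n\<close> are periodic; the last one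
  even vanishes when \<open>m\<close> is one of \<open>3\<close>, \<open>9\<close>, \<open>27\<close>, \<open>81\<close>, \<open>243\<close>. If \<open>N\<close>, \<open>P\<close>, \<open>Q\<close> are multiples of
  the periods, then the equation modulo \<open>m\<close> depends only on the class
  \<open>(a mod N, b mod N, c mod P, d mod Q)\<close>, and heuristically one class in \<open>m\<close> passes. There are
  many \<open>m\<close> whose periods all divide the same smooth number. The sieve therefore alternates
  between multiplying \<open>N\<close>, \<open>P\<close>, \<open>Q\<close> by small factors and discarding the classes that fail modulo
  some \<open>m\<close>, and the number of live classes stays small.

  Some classes are hard to remove. A solution of \<open>F\<^sub>a + F\<^sub>b = 2\<^sup>x + 3\<^sup>y\<close> with arbitrary integer
  indices \<open>a\<close>, \<open>b\<close> and with \<open>y < 5\<close> passes modulo every \<open>m\<close> coprime to \<open>6\<close>, because modulo such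
  an \<open>m\<close> negative indices and the negative exponent \<open>d = y - 5\<close> make sense. Most of
  the classes that are left after the moduli \<open>11, 5, 3, 41, 61, 9, 31\<close> come from
  such solutions. They contradict the factor \<open>3\<^sup>5\<close>, so the moduli \<open>27\<close>, \<open>81\<close> and \<open>243\<close> dispose of
  them. The periods modulo these powers of \<open>3\<close> force \<open>N\<close>, \<open>P\<close> and \<open>Q\<close> to be multiplied by \<open>3\<close>
  repeatedly, and the primes \<open>19\<close>, \<open>181\<close>, \<open>541\<close>, \<open>271\<close> and \<open>1621\<close> deal with the additional classes
  that this creates.

  The sieve is a function evaluated inside the logic (lemma \<open>sieve_exhausts\<close>), and lemma
  \<open>covers_sieve\<close> shows that it never loses a solution. The evaluation is by rewriting, where a
  single step can cost time proportional to the size of the terms that it touches. This dictates the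
  data structures: residues are kept in binary tries, classes in trees, and the
  functions that pass these large terms around are given by first-order equations.
\<close>

section \<open>Linear recurrences modulo m\<close>

definition recurrent :: "nat \<Rightarrow> nat \<Rightarrow> (nat \<Rightarrow> nat) \<Rightarrow> bool" where
  "recurrent p q s \<longleftrightarrow> (\<forall>n. s (n + 2) = p * s (n + 1) + q * s n)"

lemma recurrent_mod:
  assumes "recurrent p q s"
  shows "s (n + 2) mod m = (p * (s (n + 1) mod m) + q * (s n mod m)) mod m"
proof -
  have "s (n + 2) = p * s (n + 1) + q * s n" using assms by (simp only: recurrent_def)
  then show ?thesis by (simp only: mod_add_cong[OF mod_mult_right_eq mod_mult_right_eq])
qed

lemma recurrent_periodic:
  assumes "recurrent p q s" "s N mod m = s 0 mod m" "s (N + 1) mod m = s 1 mod m"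
  shows "s (n mod N) mod m = s n mod m"
proof -
  have shift: "s (n + N) mod m = s n mod m \<and> s (n + N + 1) mod m = s (n + 1) mod m" for n
  proof (induction n)
    case (Suc n)
    then show ?case
      using recurrent_mod[OF assms(1), of "n + N" m] recurrent_mod[OF assms(1), of n m] by simp
  qed (use assms in simp)
  have "s (r + k * N) mod m = s r mod m" for r k
  proof (induction k)
    case (Suc k)
    then show ?case using shift[of "r + k * N"] by (simp add: algebra_simps)
  qed simp
  from this[of "n mod N" "n div N"] show ?thesis by simp
qed

section \<open>Tables of residues\<close>

text \<open>
  An infinite array indexed by binary numerals: the bits of the index, read from the least
  significant one, are a path into the trie. Access takes logarithmically many rewrite steps.
\<close>

datatype table = Empty | Node nat table table

fun lookup :: "num \<Rightarrow> table \<Rightarrow> nat" where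
  "lookup k Empty = 0"
| "lookup num.One (Node x l r) = x"
| "lookup (num.Bit0 k) (Node x l r) = lookup k l"
| "lookup (num.Bit1 k) (Node x l r) = lookup k r"

fun update :: "num \<Rightarrow> nat \<Rightarrow> table \<Rightarrow> table" where
  "update num.One x Empty = Node x Empty Empty"
| "update num.One x (Node y l r) = Node x l r"
| "update (num.Bit0 k) x Empty = Node 0 (update k x Empty) Empty"
| "update (num.Bit0 k) x (Node y l r) = Node y (update k x l) r"
| "update (num.Bit1 k) x Empty = Node 0 Empty (update k x Empty)"
| "update (num.Bit1 k) x (Node y l r) = Node y l (update k x r)"

lemma lookup_update: "lookup j (update k x t) = (if j = k then x else lookup j t)"
  by (induction k x t arbitrary: j rule: update.induct; case_tac j; simp)

text \<open>Numerals start at one, hence the shift of the index.\<close>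

definition entry :: "table \<Rightarrow> nat \<Rightarrow> nat" where
  "entry t i = lookup (num_of_nat (i + 1)) t"

definition set_entry :: "nat \<Rightarrow> nat \<Rightarrow> table \<Rightarrow> table" where
  "set_entry i x t = update (num_of_nat (i + 1)) x t"

lemma entry_set_entry: "entry (set_entry i x t) j = (if j = i then x else entry t j)"
proof -
  have "num_of_nat (j + 1) = num_of_nat (i + 1) \<longleftrightarrow> j = i"
    by (metis add_right_cancel num_of_nat_inverse zero_less_Suc Suc_eq_plus1)
  then show ?thesis by (simp add: entry_def set_entry_def lookup_update)
qed

fun fill :: "nat \<Rightarrow> nat \<Rightarrow> nat \<Rightarrow> nat list \<Rightarrow> nat \<Rightarrow> nat \<Rightarrow> table \<Rightarrow> table" where
  "fill m p q [] x y t = t"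
| "fill m p q (i # is) x y t = fill m p q is y ((p * y + q * x) mod m) (set_entry i x t)"

text \<open>
  Two entries beyond the presumed period \<open>N\<close> are stored, so that the table itself shows
  whether \<open>N\<close> is one: a second-order recurrence closes up once two consecutive
  residues recur.
\<close>

definition residues :: "nat \<Rightarrow> nat \<Rightarrow> nat \<Rightarrow> nat \<Rightarrow> nat \<Rightarrow> nat \<Rightarrow> table" where
  "residues m p q x y N = fill m p q [0..<N + 2] (x mod m) (y mod m) Empty"

definition closes :: "table \<Rightarrow> nat \<Rightarrow> bool" where
  "closes t N \<longleftrightarrow> entry t N = entry t 0 \<and> entry t (N + 1) = entry t 1"

lemma entry_fill:
  assumes "recurrent p q s"
  shows "entry (fill m p q [k..<k + n] (s k mod m) (s (k + 1) mod m) t) i =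
    (if k \<le> i \<and> i < k + n then s i mod m else entry t i)"
proof (induction n arbitrary: k t)
  case (Suc n)
  have "[k..<k + Suc n] = k # [k + 1..<(k + 1) + n]"
    by (subst upt_conv_Cons) simp_all
  then have "fill m p q [k..<k + Suc n] (s k mod m) (s (k + 1) mod m) t =
      fill m p q [k + 1..<(k + 1) + n] (s (k + 1) mod m) (s (k + 1 + 1) mod m)
        (set_entry k (s k mod m) t)"
    using recurrent_mod[OF assms, of k m] by simp
  then show ?case by (simp only: Suc) (auto simp: entry_set_entry)
qed simp

lemma entry_residues:
  assumes "recurrent p q s" "closes (residues m p q (s 0) (s 1) N) N" "0 < N"
  shows "entry (residues m p q (s 0) (s 1) N) (n mod N) = s n mod m"
proof -
  have entry: "entry (residues m p q (s 0) (s 1) N) i = s i mod m" if "i < N + 2" for i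
    using entry_fill[OF assms(1), of m 0 "N + 2" Empty i] that by (simp add: residues_def)
  have "n mod N < N + 2" using assms(3) by (simp add: less_Suc_eq trans_less_add1)
  then have "entry (residues m p q (s 0) (s 1) N) (n mod N) = s (n mod N) mod m"
    by (rule entry)
  also have "\<dots> = s n mod m"
  proof (rule recurrent_periodic[OF assms(1)])
    show "s N mod m = s 0 mod m" "s (N + 1) mod m = s 1 mod m"
      using assms(2,3) entry[of 0] entry[of 1] entry[of N] entry[of "N + 1"]
      unfolding closes_def by simp_all
  qed
  finally show ?thesis .
qed

section \<open>Sets of residue classes\<close>

text \<open>
  A set of classes is a tree rather than a list: with thousands of classes in a
  list, every rewrite step of a recursion along the list would touch its long tail.
\<close>

datatype classes = Nothing | Class nat nat nat nat | Split classes classes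

primrec members :: "classes \<Rightarrow> (nat \<times> nat \<times> nat \<times> nat) set" where
  "members Nothing = {}"
| "members (Class a b c d) = {(a, b, c, d)}"
| "members (Split s t) = members s \<union> members t"

fun join :: "classes \<Rightarrow> classes \<Rightarrow> classes" where
  "join Nothing t = t"
| "join s Nothing = s"
| "join s t = Split s t"

lemma members_join: "members (join s t) = members s \<union> members t"
  by (cases "(s, t)" rule: join.cases) auto

fun classes_of_list :: "(nat \<times> nat \<times> nat \<times> nat) list \<Rightarrow> classes" where
  "classes_of_list [] = Nothing"
| "classes_of_list ((a, b, c, d) # xs) = join (Class a b c d) (classes_of_list xs)"

lemma members_classes_of_list: "members (classes_of_list xs) = set xs"
  by (induction xs rule: classes_of_list.induct) (auto simp: members_join)

section \<open>The sieve\<close>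

fun lifts :: "table \<Rightarrow> nat \<Rightarrow> nat list \<Rightarrow> (nat \<times> nat) list" where
  "lifts t a [] = []"
| "lifts t a (k # ks) = (a + k, entry t (a + k)) # lifts t a ks"

lemma set_lifts: "set (lifts t a ks) = (\<lambda>k. (a + k, entry t (a + k))) ` set ks"
  by (induction ks) auto

definition multiples :: "nat \<Rightarrow> nat \<Rightarrow> nat list" where
  "multiples N f = [N * i. i \<leftarrow> [0..<f]]"

lemma mem_set_lifts:
  assumes "0 < N * f" "entry t (n mod (N * f)) = x"
  shows "(n mod (N * f), x) \<in> set (lifts t (n mod N) (multiples N f))"
proof -
  have "n mod (N * f) = n mod N + N * (n div N mod f)"
    by (simp add: mod_mult2_eq)
  moreover have "N * (n div N mod f) \<in> set (multiples N f)"
    using assms(1) by (simp add: multiples_def)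
  ultimately show ?thesis
    unfolding set_lifts using assms(2) by (intro image_eqI) auto
qed

definition pair_sums ::
    "nat \<Rightarrow> (nat \<times> nat) list \<Rightarrow> (nat \<times> nat) list \<Rightarrow> (nat \<times> nat \<times> nat) list" where
  "pair_sums m xs ys = [(a, b, (u + v) mod m). (a, u) \<leftarrow> xs, (b, v) \<leftarrow> ys]"

definition matches ::
    "(nat \<times> nat \<times> nat) list \<Rightarrow> (nat \<times> nat \<times> nat) list \<Rightarrow> (nat \<times> nat \<times> nat \<times> nat) list" where
  "matches ls rs = [(a, b, c, d). (a, b, u) \<leftarrow> ls, (c, d, v) \<leftarrow> rs, u = v]"

lemma mem_set_pair_sums:
  assumes "(a, u mod m) \<in> set xs" "(b, v mod m) \<in> set ys"
  shows "(a, b, (u + v) mod m) \<in> set (pair_sums m xs ys)"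
  unfolding pair_sums_def using assms by (force simp: mod_add_eq)

lemma mem_set_matches:
  assumes "(a, b, u) \<in> set ls" "(c, d, u) \<in> set rs"
  shows "(a, b, c, d) \<in> set (matches ls rs)"
  unfolding matches_def using assms by force

fun survivors ::
    "nat \<Rightarrow> table \<Rightarrow> table \<Rightarrow> table \<Rightarrow> nat list \<Rightarrow> nat list \<Rightarrow> nat list \<Rightarrow> classes \<Rightarrow> classes" where
  "survivors m t t2 t3 ns cs ds Nothing = Nothing"
| "survivors m t t2 t3 ns cs ds (Class a b c d) =
    classes_of_list (matches (pair_sums m (lifts t a ns) (lifts t b ns))
      (pair_sums m (lifts t2 c cs) (lifts t3 d ds)))"
| "survivors m t t2 t3 ns cs ds (Split l r) =
    join (survivors m t t2 t3 ns cs ds l) (survivors m t t2 t3 ns cs ds r)"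

text \<open>The tree is traversed class by class, so it suffices to consider a single class.\<close>

lemma members_survivors:
  "members (survivors m t t2 t3 ns cs ds C) =
    (\<Union>(a, b, c, d) \<in> members C. members (survivors m t t2 t3 ns cs ds (Class a b c d)))"
  by (induction C) (auto simp: members_join)

type_synonym state = "bool \<times> nat \<times> nat \<times> nat \<times> classes"

text \<open>
  The Boolean component of a state records whether all presumed periods so far were correct.
  The tables are arguments of a function of their own, so that they are computed only once.
\<close>

fun advance :: "nat \<Rightarrow> nat \<Rightarrow> nat \<Rightarrow> nat \<Rightarrow> table \<Rightarrow> table \<Rightarrow> table \<Rightarrow> state \<Rightarrow> state" where
  "advance m f g h t t2 t3 (ok, N, P, Q, C) =
    (ok \<and> 0 < N * f \<and> 0 < P * g \<and> 0 < Q * h \<and>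
       closes t (N * f) \<and> closes t2 (P * g) \<and> closes t3 (Q * h),
     N * f, P * g, Q * h,
     survivors m t t2 t3 (multiples N f) (multiples P g) (multiples Q h) C)"

text \<open>
  The sequences \<open>F\<^sub>n\<close>, \<open>2\<^sup>n\<close> and \<open>3\<^sup>5 3\<^sup>n\<close> are treated as second-order recurrences with the
  coefficients \<open>(1, 1)\<close>, \<open>(2, 0)\<close> and \<open>(3, 0)\<close>.
\<close>

fun sieve :: "nat \<times> nat \<times> nat \<times> nat \<Rightarrow> state \<Rightarrow> state" where
  "sieve (m, f, g, h) (ok, N, P, Q, C) =
    advance m f g h (residues m 1 1 0 1 (N * f)) (residues m 2 0 1 2 (P * g))
      (residues m 3 0 243 729 (Q * h)) (ok, N, P, Q, C)"

text \<open>Wrong periods would make the classes meaningless, so a failed state covers everything.\<close>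

fun covers :: "nat \<Rightarrow> nat \<Rightarrow> nat \<Rightarrow> nat \<Rightarrow> state \<Rightarrow> bool" where
  "covers a b c d (ok, N, P, Q, C) \<longleftrightarrow>
    (ok \<longrightarrow> (a mod N, b mod N, c mod P, d mod Q) \<in> members C)"

lemma covers_sieve:
  assumes eq: "fib a + fib b = 2 ^ c + 243 * 3 ^ d" and cov: "covers a b c d S"
  shows "covers a b c d (sieve k S)"
proof -
  obtain m f g h where k: "k = (m, f, g, h)" by (cases k)
  obtain ok N P Q C where S: "S = (ok, N, P, Q, C)" by (cases S)
  define t where "t = residues m 1 1 0 1 (N * f)"
  define t2 where "t2 = residues m 2 0 1 2 (P * g)"
  define t3 where "t3 = residues m 3 0 243 729 (Q * h)"
  have "(a mod (N * f), b mod (N * f), c mod (P * g), d mod (Q * h)) \<in>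
      members (survivors m t t2 t3 (multiples N f) (multiples P g) (multiples Q h) C)"
    if ok: "ok" and pos: "0 < N * f" "0 < P * g" "0 < Q * h"
      and closes: "closes t (N * f)" "closes t2 (P * g)" "closes t3 (Q * h)"
  proof -
    have "recurrent 1 1 fib" "recurrent 2 0 (\<lambda>n. 2 ^ n)" "recurrent 3 0 (\<lambda>n. 243 * 3 ^ n)"
      by (simp_all add: recurrent_def)
    then have "entry t (n mod (N * f)) = fib n mod m"
      and "entry t2 (n mod (P * g)) = 2 ^ n mod m"
      and "entry t3 (n mod (Q * h)) = 243 * 3 ^ n mod m" for n
      using closes pos entry_residues[of 1 1 fib m "N * f" n]
        entry_residues[of 2 0 "\<lambda>n. 2 ^ n" m "P * g" n]
        entry_residues[of 3 0 "\<lambda>n. 243 * 3 ^ n" m "Q * h" n]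
      by (simp_all add: t_def t2_def t3_def)
    then have "(a mod (N * f), fib a mod m) \<in> set (lifts t (a mod N) (multiples N f))"
      and "(b mod (N * f), fib b mod m) \<in> set (lifts t (b mod N) (multiples N f))"
      and "(c mod (P * g), 2 ^ c mod m) \<in> set (lifts t2 (c mod P) (multiples P g))"
      and "(d mod (Q * h), 243 * 3 ^ d mod m) \<in> set (lifts t3 (d mod Q) (multiples Q h))"
      using pos by (auto intro!: mem_set_lifts)
    then have "(a mod (N * f), b mod (N * f), (fib a + fib b) mod m) \<in>
        set (pair_sums m (lifts t (a mod N) (multiples N f)) (lifts t (b mod N) (multiples N f)))"
      and "(c mod (P * g), d mod (Q * h), (2 ^ c + 243 * 3 ^ d) mod m) \<in>
        set (pair_sums m (lifts t2 (c mod P) (multiples P g)) (lifts t3 (d mod Q) (multiples Q h)))"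
      by - (rule mem_set_pair_sums; assumption)+
    then have "(a mod (N * f), b mod (N * f), c mod (P * g), d mod (Q * h)) \<in>
        members (survivors m t t2 t3 (multiples N f) (multiples P g) (multiples Q h)
          (Class (a mod N) (b mod N) (c mod P) (d mod Q)))"
      unfolding eq survivors.simps members_classes_of_list by (rule mem_set_matches)
    moreover have "(a mod N, b mod N, c mod P, d mod Q) \<in> members C"
      using cov ok by (simp add: S)
    ultimately show ?thesis by (subst members_survivors) blast
  qed
  then show ?thesis by (simp add: k S t_def t2_def t3_def)
qed

section \<open>The equation has no solution with a large power of 3\<close>

text \<open>
  An entry \<open>(m, f, g, h)\<close> asks for a sieving modulo \<open>m\<close> after the moduli for the indices, for the
  exponent of \<open>2\<close> and for the exponent of \<open>3\<close> have been multiplied by \<open>f\<close>, \<open>g\<close> and \<open>h\<close>.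
  The factors are the least ones that make the new moduli multiples of the periods modulo \<open>m\<close>.
\<close>

definition certificate :: "(nat \<times> nat \<times> nat \<times> nat) list" where
  "certificate =
    [(11, 10, 10, 5), (5, 2, 2, 4), (3, 2, 1, 1), (41, 1, 1, 2), (61, 3, 3, 1), (9, 1, 1, 1),
     (31, 1, 1, 3), (27, 3, 3, 1), (19, 1, 1, 3), (181, 1, 1, 1), (541, 1, 3, 3), (81, 3, 1, 1),
     (271, 1, 1, 1), (243, 3, 3, 1), (1621, 1, 1, 1)]"

lemma sieve_exhausts:
  "fold sieve certificate (True, 1, 1, 1, Class 0 0 0 0) = (True, 3240, 1620, 1080, Nothing)"
  by code_simp

lemma no_solution_3_pow_5: "fib a + fib b \<noteq> 2 ^ c + 243 * 3 ^ d"
proof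
  assume eq: "fib a + fib b = 2 ^ c + 243 * 3 ^ d"
  have "covers a b c d (fold sieve ks S)" if "covers a b c d S" for ks S
    using that by (induction ks arbitrary: S) (simp_all add: covers_sieve[OF eq])
  from this[of "(True, 1, 1, 1, Class 0 0 0 0)" certificate, unfolded sieve_exhausts]
  show False by simp
qed

section \<open>The finitely many remaining cases\<close>

lemma small_solutions:
  "[(n1, n2, z1, z2). n1 \<leftarrow> [0..<12], n2 \<leftarrow> [0..<n1 + 1], z2 \<leftarrow> [0..<5], z1 \<leftarrow> [0..<z2 + 1],
      fib n1 + fib n2 = 2 ^ z1 + 3 ^ z2] =
    [(1,1,0,0), (2,1,0,0), (2,2,0,0), (3,0,0,0), (3,3,0,1), (4,1,0,1), (4,2,0,1), (4,3,1,1),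
     (5,0,1,1), (5,5,0,2), (6,3,0,2), (6,4,1,2), (6,5,2,2), (7,0,2,2), (8,6,1,3), (9,1,3,3),
     (9,2,3,3), (10,9,3,4), (11,0,3,4), (11,6,4,4)]"
  by code_simp
theorem theorem2:
  shows "{(n1, n2, z1, z2).
            n1 \<ge> n2 \<and> z2 \<ge> z1 \<and> fib n1 + fib n2 = 2 ^ z1 + 3 ^ z2} =
         {(3,0,0,0), (5,0,1,1), (7,0,2,2), (11,0,3,4), (1,1,0,0), (2,1,0,0), (2,2,0,0),
          (3,3,0,1), (4,1,0,1), (4,2,0,1), (4,3,1,1), (5,5,0,2), (6,3,0,2), (6,4,1,2),
          (6,5,2,2), (8,6,1,3), (9,1,3,3), (9,2,3,3), (10,9,3,4), (11,6,4,4)}"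
    (is "?L = ?R")
proof -
  let ?small = "[(n1, n2, z1, z2). n1 \<leftarrow> [0..<12], n2 \<leftarrow> [0..<n1 + 1], z2 \<leftarrow> [0..<5],
    z1 \<leftarrow> [0..<z2 + 1], fib n1 + fib n2 = 2 ^ z1 + 3 ^ z2]"
  have bounds: "n1 < 12 \<and> z2 < 5"
    if le: "n2 \<le> n1" "z1 \<le> z2" and eq: "fib n1 + fib n2 = 2 ^ z1 + 3 ^ z2" for n1 n2 z1 z2
  proof -
    have z2: "z2 < 5"
    proof (rule ccontr)
      assume "\<not> z2 < 5"
      then obtain d where "z2 = 5 + d" using le_Suc_ex by (metis not_less)
      then show False using eq no_solution_3_pow_5[of n1 n2 z1 d] by (simp add: power_add)
    qed
    have "n1 < 12"
    proof (rule ccontr)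
      (* The right-hand side is at most 16 + 81 = 97, which is less than fib 12 = 144. *)
      assume "\<not> n1 < 12"
      then have "fib 12 \<le> fib n1" by (intro fib_mono) simp
      moreover have "fib 12 = 144" by code_simp
      moreover have "(2::nat) ^ z1 \<le> 2 ^ 4" "(3::nat) ^ z2 \<le> 3 ^ 4"
        using z2 le power_increasing[of z1 4 "2::nat"] power_increasing[of z2 4 "3::nat"]
        by simp_all
      ultimately show False using eq by simp
    qed
    with z2 show ?thesis by simp
  qed
  have "?L = set ?small"
  proof -
    (* Keeping the index ranges symbolic prevents a split into hundreds of cases. *)
    have "x \<in> set [0..<k] \<longleftrightarrow> x < k" for x k :: nat by simp
    with bounds show ?thesis
      by (auto simp del: set_upt upt_Suc simp: less_Suc_eq_le Bex_def)
  qed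
  also have "\<dots> = ?R" unfolding small_solutions by auto
  finally show ?thesis .
qed

end
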